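(* Let $\mathcal{Z}$ be a finite state space with $|\mathcal{Z}|=N\ge 2$, let $\mathcal{T}$ be a non-empty, compact and convex set of transition matrices on $\mathcal{Z}$ with separately specified rows, and let $A\subset\mathcal{Z}$ be a closed target set. Let $A^c=\mathcal{Z}\setminus A$, let $\mathscr{A}_{\mathcal{T}}$ be the set of all $z\in A^c$ from which $A$ is not lower reachable, let $\mathscr{U}_{\mathcal{T}}$ be the set of all $z\in A^c\setminus\mathscr{A}_{\mathcal{T}}$ from which $\mathscr{A}_{\mathcal{T}}$ is upper reachable, let $\mathscr{B}_{\mathcal{T}}:=\mathscr{A}_{\mathcal{T}}\cup\mathscr{U}_{\mathcal{T}}$, and let $W:=\mathcal{Z}\setminus\mathscr{B}_{\mathcal{T}}$, assumed non-empty. Let $\mathcal{T}|_{W}:=\{T|_W: T\in\mathcal{T}\}$. Then $\mathcal{T}|_W$ is a set of transition matrices on $W$ with respect to which $A$ is lower reachable from every state $z\in W\setminus A$. Consequently, the following iteration computes the upper expected hitting time on $W$: let $T_1$ be any extreme point of $\mathcal{T}|_W$ and, for each $n\ge 1$, let $h_n\in\mathbb{R}^{W}$ be the unique solution of the linear system $h_n=\mathbb{1}_{W\setminus A}+\mathbb{1}_{W\setminus A}\cdot T_nh_n$ and let $T_{n+1}$ be any extreme point of $\mathcal{T}|_W$ such that $[T_{n+1}h_n](z)=\sup_{T\in\mathcal{T}|_W}[Th_n](z)$ for all $z\in W$. Then $\lim_{n\to\infty}h_n(z)=\overline{h}^{\mathcal{T}}_A(z)$ for all $z\in W$.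
   Context: A transition matrix on $\mathcal{Z}$ is a row-stochastic matrix $T=(T(z,z'))_{z,z'\in\mathcal{Z}}$; it acts on functions $f:\mathcal{Z}\to\mathbb{R}$ by $[Tf](z)=\sum_{z'}T(z,z')f(z')$. $\mathcal{T}$ has separately specified rows if there are sets $\mathcal{T}_z$ ($z\in\mathcal{Z}$) of probability mass functions on $\mathcal{Z}$ such that $\mathcal{T}$ consists of exactly the transition matrices $T$ with $T(z,\cdot)\in\mathcal{T}_z$ for all $z$. Upper and lower transition operators of a set $\mathcal{T}$ of transition matrices: $[\overline{T}f](z):=\sup_{T\in\mathcal{T}}[Tf](z)$ and $[\underline{T}f](z):=\inf_{T\in\mathcal{T}}[Tf](z)$. Write $\mathbb{1}_{C}$ for the indicator of a set $C$ and $\cdot$ for the element-wise product. $C$ is upper reachable from $z$ (with respect to $\mathcal{T}$) if there is $n\in\mathbb{N}=\{1,2,\dots\}$ with $[\overline{T}^n\mathbb{1}_{C}](z)>0$, and lower reachable from $z$ if there is $n\in\mathbb{N}$ with $[\underline{T}^n\mathbb{1}_{C}](z)>0$. The same notions apply on the state space $W$ with $\mathcal{T}|_W$ in place of $\mathcal{T}$. The set $A$ is closed if $T(x,y)=0$ for all $x\in A$, $y\notin A$ and all $T\in\mathcal{T}$. Hitting time: for a stochastic process $(Z_n)_{n\ge 0}$ on $\mathcal{Z}$, $\tau_A:=\inf\{n\ge 0: Z_n\in A\}\in\{0,1,2,\dots\}\cup\{+\infty\}$. The upper expected hitting time is $\overline{h}^{\mathcal{T}}_A(z):=\sup_{T\in\mathcal{T}}\mathbb{E}_{T}[\tau_A\mid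 Z_0=z]\in[0,+\infty]$, where $\mathbb{E}_T$ is expectation for the homogeneous Markov chain with transition matrix $T$. For $B\subseteq\mathcal{Z}$, $T|_{B}=(T(i,j))_{i,j\in B}$ is the submatrix of $T$ indexed by $B$. *)

theory Defs
  imports "HOL-Probability.Probability"
begin

section \<open>Transition matrices\<close>

text \<open>
  The state space is a finite type \<open>'z\<close>. Objects on a sub-state-space \<open>S\<close> (matrices indexed by
  \<open>S \<times> S\<close>, vectors indexed by \<open>S\<close>) are represented by matrices and vectors over \<open>'z\<close> all of whose
  entries outside \<open>S \<times> S\<close>, respectively outside \<open>S\<close>, are zero. This is a linear embedding, so it
  preserves and reflects convexity, compactness and extreme points. The action of a matrix
  on a function is the library's \<open>T *v f\<close>; because of the zero padding, the sum in
  \<open>(T *v f) $ z\<close> effectively ranges over \<open>S\<close> when \<open>T\<close> is a matrix on \<open>S\<close>.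
\<close>

definition transition_matrix_on :: "'z set \<Rightarrow> real ^ 'z ^ 'z::finite \<Rightarrow> bool" where
  "transition_matrix_on S T \<longleftrightarrow>
     (\<forall>x\<in>S. (\<forall>y\<in>S. 0 \<le> T $ x $ y) \<and> (\<Sum>y\<in>S. T $ x $ y) = 1) \<and>
     (\<forall>x y. x \<notin> S \<or> y \<notin> S \<longrightarrow> T $ x $ y = 0)"

abbreviation transition_matrix :: "real ^ 'z ^ 'z::finite \<Rightarrow> bool" where
  "transition_matrix \<equiv> transition_matrix_on UNIV"

definition prob_mass_function :: "real ^ 'z::finite \<Rightarrow> bool" where
  "prob_mass_function p \<longleftrightarrow> (\<forall>y. 0 \<le> p $ y) \<and> (\<Sum>y\<in>UNIV. p $ y) = 1"

definition separately_specified_rows :: "(real ^ 'z ^ 'z::finite) set \<Rightarrow> bool" where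
  "separately_specified_rows \<T> \<longleftrightarrow>
     (\<exists>R :: 'z \<Rightarrow> (real ^ 'z) set.
        (\<forall>z. \<forall>p\<in>R z. prob_mass_function p) \<and>
        \<T> = {T. transition_matrix T \<and> (\<forall>z. row z T \<in> R z)})"

definition restrict_matrix :: "'z set \<Rightarrow> real ^ 'z ^ 'z::finite \<Rightarrow> real ^ 'z ^ 'z" where
  "restrict_matrix B T = (\<chi> i j. if i \<in> B \<and> j \<in> B then T $ i $ j else 0)"

definition closed_target :: "(real ^ 'z ^ 'z::finite) set \<Rightarrow> 'z set \<Rightarrow> bool" where
  "closed_target \<T> A \<longleftrightarrow> (\<forall>T\<in>\<T>. \<forall>x\<in>A. \<forall>y. y \<notin> A \<longrightarrow> T $ x $ y = 0)"


section \<open>Upper and lower transition operators, reachability\<close>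

definition ind :: "'z set \<Rightarrow> real ^ 'z::finite" where
  "ind C = (\<chi> z. indicator C z)"

definition upper_op :: "(real ^ 'z ^ 'z::finite) set \<Rightarrow> real ^ 'z \<Rightarrow> real ^ 'z" where
  "upper_op \<T> f = (\<chi> z. SUP T\<in>\<T>. (T *v f) $ z)"

definition lower_op :: "(real ^ 'z ^ 'z::finite) set \<Rightarrow> real ^ 'z \<Rightarrow> real ^ 'z" where
  "lower_op \<T> f = (\<chi> z. INF T\<in>\<T>. (T *v f) $ z)"

definition upper_reachable :: "(real ^ 'z ^ 'z::finite) set \<Rightarrow> 'z set \<Rightarrow> 'z \<Rightarrow> bool" where
  "upper_reachable \<T> C z \<longleftrightarrow> (\<exists>n\<ge>1. 0 < (upper_op \<T> ^^ n) (ind C) $ z)"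

definition lower_reachable :: "(real ^ 'z ^ 'z::finite) set \<Rightarrow> 'z set \<Rightarrow> 'z \<Rightarrow> bool" where
  "lower_reachable \<T> C z \<longleftrightarrow> (\<exists>n\<ge>1. 0 < (lower_op \<T> ^^ n) (ind C) $ z)"

definition not_lower_reaching :: "(real ^ 'z ^ 'z::finite) set \<Rightarrow> 'z set \<Rightarrow> 'z set" where
  "not_lower_reaching \<T> A = {z \<in> - A. \<not> lower_reachable \<T> A z}"

definition upper_reaching_bad :: "(real ^ 'z ^ 'z::finite) set \<Rightarrow> 'z set \<Rightarrow> 'z set" where
  "upper_reaching_bad \<T> A =
     {z \<in> - A - not_lower_reaching \<T> A. upper_reachable \<T> (not_lower_reaching \<T> A) z}"

definition bad_states :: "(real ^ 'z ^ 'z::finite) set \<Rightarrow> 'z set \<Rightarrow> 'z set" where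
  "bad_states \<T> A = not_lower_reaching \<T> A \<union> upper_reaching_bad \<T> A"


section \<open>Homogeneous Markov chains and hitting times\<close>

definition step_kernel ::
    "real ^ 'z ^ 'z::finite \<Rightarrow> 'z \<Rightarrow> nat \<Rightarrow> (nat \<Rightarrow> 'z) \<Rightarrow> 'z measure" where
  "step_kernel T z n \<omega> =
     (case n of 0 \<Rightarrow> return (count_space UNIV) z
      | Suc m \<Rightarrow> measure_pmf (embed_pmf (\<lambda>y. T $ \<omega> m $ y)))"

text \<open>
  The law on path space of the homogeneous Markov chain with transition matrix \<open>T\<close> started in
  \<open>z\<close>, obtained from the Ionescu-Tulcea theorem; \<open>Z\<^sub>n\<close> is the \<open>n\<close>-th coordinate. The lemma
  \<open>emeasure_markov_chain\<close> below confirms the finite-dimensional distributions.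
\<close>

definition markov_chain :: "real ^ 'z ^ 'z::finite \<Rightarrow> 'z \<Rightarrow> (nat \<Rightarrow> 'z) measure" where
  "markov_chain T z =
     projective_family.lim UNIV
       (Ionescu_Tulcea.CI (step_kernel T z) (\<lambda>_. count_space UNIV)) (\<lambda>_. count_space UNIV)"

lemma Ionescu_Tulcea_step_kernel:
  "Ionescu_Tulcea (step_kernel T z) (\<lambda>_. count_space (UNIV :: 'z::finite set))"
proof (rule Ionescu_Tulcea.intro)
  let ?M = "\<lambda>_::nat. count_space (UNIV :: 'z set)"
  show "step_kernel T z i \<in> measurable (PiM {0..<i} ?M) (subprob_algebra (count_space UNIV))" for i
  proof (cases i)
    case 0
    then show ?thesis
      by (auto simp: step_kernel_def[abs_def] space_subprob_algebra
          intro!: prob_space_imp_subprob_space prob_space_return)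
  next
    case (Suc m)
    have "(\<lambda>\<omega>. \<omega> m) \<in> measurable (PiM {0..<i} ?M) (count_space UNIV)"
      using Suc by (intro measurable_component_singleton) auto
    moreover have "(\<lambda>x. measure_pmf (embed_pmf (\<lambda>y. T $ x $ y)))
        \<in> measurable (count_space UNIV) (subprob_algebra (count_space UNIV))"
      by (auto simp: space_subprob_algebra measure_pmf.subprob_space_axioms)
    ultimately show ?thesis
      using Suc by (auto simp: step_kernel_def[abs_def] dest: measurable_compose)
  qed
  show "prob_space (step_kernel T z i x)" for i x
    by (auto simp: step_kernel_def prob_space_return measure_pmf.prob_space_axioms split: nat.split)
qed

lemma emeasure_markov_chain:
  fixes T :: "real ^ 'z ^ 'z::finite"
  assumes T: "transition_matrix T"
  shows "emeasure (markov_chain T z) {\<omega>. \<forall>i\<le>n. \<omega> i = x i} =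
    (if x 0 = z then ennreal (\<Prod>i<n. T $ x i $ x (Suc i)) else 0)"
proof -
  let ?M = "\<lambda>_::nat. count_space (UNIV :: 'z set)"
  interpret IT: Ionescu_Tulcea "step_kernel T z" ?M
    by (rule Ionescu_Tulcea_step_kernel)
  have nn: "0 \<le> T $ a $ b" and s1: "(\<Sum>y\<in>UNIV. T $ a $ y) = 1" for a b
    using T by (auto simp: transition_matrix_on_def)
  have pmf: "pmf (embed_pmf (\<lambda>y. T $ a $ y)) b = T $ a $ b" for a b
    by (rule pmf_embed_pmf) (auto simp: nn s1 nn_integral_count_space_finite sum_ennreal)
  have sing: "{restrict x {0..<m}} \<in> sets (PiM {0..<m} ?M)" for m
  proof -
    have "{restrict x {0..<m}} = PiE {0..<m} (\<lambda>i. {x i})"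
      by (auto simp: PiE_iff extensional_def restrict_def fun_eq_iff)
    also have "\<dots> \<in> sets (PiM {0..<m} ?M)"
      by (rule sets_PiM_I_finite) auto
    finally show ?thesis .
  qed
  have und: "(\<lambda>_. undefined) \<in> space (PiM {0..<0} ?M)"
    by (auto simp: space_PiM)
  have step: "emeasure (IT.C 0 (Suc m) (\<lambda>_. undefined)) {restrict x {0..<Suc m}} =
      emeasure (step_kernel T z m (restrict x {0..<m})) {x m} *
      emeasure (IT.C 0 m (\<lambda>_. undefined)) {restrict x {0..<m}}" for m
  proof -
    let ?C = "IT.C 0 m (\<lambda>_. undefined)"
    have spC: "space ?C = space (PiM {0..<m} ?M)" and stC: "sets ?C = sets (PiM {0..<m} ?M)"
      using IT.space_C[OF und, of m] IT.sets_C[OF und, of m] by simp_all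
    have ne: "space ?C \<noteq> {}"
      unfolding spC by (auto simp: space_PiM PiE_eq_empty_iff)
    have meas: "IT.eP m \<in> measurable ?C (subprob_algebra (PiM {0..<Suc m} ?M))"
      using IT.measurable_eP[of m] by (simp add: measurable_cong_sets[OF stC refl])
    have "emeasure (IT.C 0 (Suc m) (\<lambda>_. undefined)) {restrict x {0..<Suc m}} =
        (\<integral>\<^sup>+\<omega>. emeasure (IT.eP m \<omega>) {restrict x {0..<Suc m}} \<partial>?C)"
      using emeasure_bind[OF ne meas sing] by simp
    also have "\<dots> = (\<integral>\<^sup>+\<omega>. emeasure (step_kernel T z m (restrict x {0..<m})) {x m} *
        indicator {restrict x {0..<m}} \<omega> \<partial>?C)"
    proof (rule nn_integral_cong)
      fix \<omega> assume "\<omega> \<in> space ?C"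
      then have w: "\<omega> \<in> space (PiM {0..<m} ?M)" using spC by simp
      then have ext: "\<omega> \<in> extensional {0..<m}" by (simp add: space_PiM PiE_def)
      have 1: "fun_upd \<omega> m a = restrict x {0..<Suc m} \<longleftrightarrow> \<omega> = restrict x {0..<m} \<and> a = x m" for a
      proof
        assume a: "fun_upd \<omega> m a = restrict x {0..<Suc m}"
        have "\<omega> i = restrict x {0..<m} i" for i
          using fun_cong[OF a, of i] ext by (cases "i < m") (auto simp: extensional_def)
        moreover have "a = x m" using fun_cong[OF a, of m] by simp
        ultimately show "\<omega> = restrict x {0..<m} \<and> a = x m" by auto
      qed (auto simp: fun_eq_iff)
      have 2: "(\<lambda>a. fun_upd \<omega> m a) -` {restrict x {0..<Suc m}} \<inter> space (count_space UNIV) =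
          (if \<omega> = restrict x {0..<m} then {x m} else {})"
        using 1 by (auto simp: vimage_def)
      show "emeasure (IT.eP m \<omega>) {restrict x {0..<Suc m}} =
          emeasure (step_kernel T z m (restrict x {0..<m})) {x m} * indicator {restrict x {0..<m}} \<omega>"
        unfolding IT.emeasure_eP[OF w sing] 2 by auto
    qed
    also have "\<dots> = emeasure (step_kernel T z m (restrict x {0..<m})) {x m} *
        emeasure ?C {restrict x {0..<m}}"
      by (rule nn_integral_cmult_indicator) (use sing stC in auto)
    finally show ?thesis .
  qed
  have C: "emeasure (IT.C 0 (Suc n) (\<lambda>_. undefined)) {restrict x {0..<Suc n}} =
      (if x 0 = z then ennreal (\<Prod>i<n. T $ x i $ x (Suc i)) else 0)" for n
  proof (induction n)
    case 0
    show ?case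
      unfolding step[of 0] using sing[of 0]
      by (auto simp: step_kernel_def restrict_def)
  next
    case (Suc n)
    have "emeasure (step_kernel T z (Suc n) (restrict x {0..<Suc n})) {x (Suc n)} =
        ennreal (T $ x n $ x (Suc n))"
      by (simp add: step_kernel_def emeasure_pmf_single pmf)
    then show ?case
      unfolding step[of "Suc n"] Suc.IH
      by (auto simp: ennreal_mult nn prod_nonneg mult.commute)
  qed
  have "{\<omega>. \<forall>i\<le>n. \<omega> i = x i} =
      prod_emb UNIV ?M {0..<Suc n} {restrict x {0..<Suc n}}"
    by (auto simp: prod_emb_def space_PiM fun_eq_iff restrict_def less_Suc_eq_le) metis
  then have "emeasure (markov_chain T z) {\<omega>. \<forall>i\<le>n. \<omega> i = x i} =
      emeasure (IT.CI {0..<Suc n}) {restrict x {0..<Suc n}}"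
    unfolding markov_chain_def by (simp add: IT.lim[OF _ sing])
  also have "\<dots> = emeasure (IT.C 0 (Suc n) (\<lambda>_. undefined))
      (prod_emb {0..<Suc n} ?M {0..<Suc n} {restrict x {0..<Suc n}})"
    by (rule IT.emeasure_CI[OF order_refl sing])
  also have "prod_emb {0..<Suc n} ?M {0..<Suc n} {restrict x {0..<Suc n}} = {restrict x {0..<Suc n}}"
    by (rule prod_emb_id) auto
  finally show ?thesis using C by simp
qed

text \<open>The infimum over the empty set of times is \<open>\<infinity>\<close>.\<close>

definition hitting_time :: "'z set \<Rightarrow> (nat \<Rightarrow> 'z) \<Rightarrow> ennreal" where
  "hitting_time A \<omega> = (INF n\<in>{n. \<omega> n \<in> A}. of_nat n)"

definition upper_expected_hitting_time ::
    "(real ^ 'z ^ 'z::finite) set \<Rightarrow> 'z set \<Rightarrow> 'z \<Rightarrow> ennreal" where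
  "upper_expected_hitting_time \<T> A z =
     (SUP T\<in>\<T>. \<integral>\<^sup>+\<omega>. hitting_time A \<omega> \<partial>markov_chain T z)"

end

(*
  No row of a state in W charges a bad state, so on W only the restricted matrices matter. Lower
  reachability of A gives a maximum principle: d <= T d off A and d <= 0 on A force d <= 0 on W.
  It yields unique solvability of the hitting equations, monotonicity of the policy iteration,
  and (via a supersolution common to all T) its boundedness. The limit u satisfies
  1 + T u <= u off A for every T, so it dominates every expected hitting time, while each h_n is
  itself an expected hitting time.
*)

theory Submission
  imports Defs
begin

section \<open>Matrices on a sub-state-space\<close>

text \<open>Lower reachability concerns an operator that may choose a different matrix at every
  state and every step, whereas each hitting equation contains a single matrix. The link is that
  \<open>lower_op\<close> lies below every \<open>T\<close> of the family: if one \<open>T\<close>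
  never leaves a set disjoint from \<open>A\<close>, all powers of \<open>lower_op\<close> at the
  indicator of \<open>A\<close> are nonpositive there.

  The bound on the iterates has to be uniform over a possibly infinite family, so finiteness of the
  solution for each single \<open>T\<close> does not suffice. The supersolution is therefore built
  from powers of \<open>lower_op\<close> itself, and one telescoping computation serves all
  \<open>T\<close>.

  Path-space measures enter only through tail probabilities. On \<open>W\<close> the probability of
  avoiding \<open>A\<close> up to time \<open>n\<close> is the \<open>n\<close>-th term of the
  Neumann series of the hitting equation; uniqueness then identifies the sum of the series with the
  solution.\<close>

lemma transition_matrix_on_nonneg:
  "transition_matrix_on W T \<Longrightarrow> 0 \<le> T $ x $ y"
  unfolding transition_matrix_on_def by (cases "x \<in> W \<and> y \<in> W") auto

lemma transition_matrix_on_outside: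
  "transition_matrix_on W T \<Longrightarrow> x \<notin> W \<or> y \<notin> W \<Longrightarrow> T $ x $ y = 0"
  unfolding transition_matrix_on_def by blast

lemma transition_matrix_on_row_sum:
  assumes "transition_matrix_on W T" "x \<in> W"
  shows "(\<Sum>y\<in>UNIV. T $ x $ y) = 1"
proof -
  have "(\<Sum>y\<in>UNIV. T $ x $ y) = (\<Sum>y\<in>W. T $ x $ y)"
    by (rule sum.mono_neutral_right) (use assms in \<open>auto simp: transition_matrix_on_def\<close>)
  then show ?thesis using assms by (simp add: transition_matrix_on_def)
qed

lemma transition_matrix_on_row_sum_le_1:
  assumes "transition_matrix_on W T"
  shows "(\<Sum>y\<in>UNIV. T $ x $ y) \<le> 1"
  using transition_matrix_on_row_sum[OF assms, of x] transition_matrix_on_outside[OF assms, of x]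
  by (cases "x \<in> W") auto

lemma transition_matrix_on_le_1:
  assumes "transition_matrix_on W T"
  shows "T $ x $ y \<le> 1"
proof -
  have "T $ x $ y \<le> (\<Sum>y\<in>UNIV. T $ x $ y)"
    by (rule member_le_sum) (auto simp: transition_matrix_on_nonneg[OF assms])
  then show ?thesis using transition_matrix_on_row_sum_le_1[OF assms, of x] by linarith
qed

lemma transition_matrix_on_mult_mono:
  assumes "transition_matrix_on W T" "\<And>y. y \<in> W \<Longrightarrow> f $ y \<le> g $ y"
  shows "(T *v f) $ x \<le> (T *v g) $ x"
  unfolding matrix_vector_mult_def vec_lambda_beta
proof (rule sum_mono)
  fix y show "T $ x $ y * f $ y \<le> T $ x $ y * g $ y"
    using assms transition_matrix_on_nonneg[OF assms(1)] transition_matrix_on_outside[OF assms(1)]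
    by (cases "y \<in> W") (auto intro: mult_left_mono)
qed

lemma transition_matrix_on_mult_nonneg:
  assumes "transition_matrix_on W T" "\<And>y. y \<in> W \<Longrightarrow> 0 \<le> f $ y"
  shows "0 \<le> (T *v f) $ x"
  using transition_matrix_on_mult_mono[of W T 0 f x] assms by simp

lemma transition_matrix_on_abs_mult_le:
  assumes "transition_matrix_on W T"
  shows "\<bar>(T *v f) $ x\<bar> \<le> (\<Sum>y\<in>UNIV. \<bar>f $ y\<bar>)"
  unfolding matrix_vector_mult_def vec_lambda_beta
  by (rule order_trans[OF sum_abs sum_mono])
    (use transition_matrix_on_nonneg[OF assms] transition_matrix_on_le_1[OF assms]
      in \<open>auto simp: abs_mult intro!: mult_left_le_one_le\<close>)

lemma bdd_mult_transition_matrices: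
  assumes "\<And>T. T \<in> \<S> \<Longrightarrow> transition_matrix_on W T"
  shows "bdd_above ((\<lambda>T. (T *v f) $ z) ` \<S>)" "bdd_below ((\<lambda>T. (T *v f) $ z) ` \<S>)"
proof -
  have b: "\<bar>(T *v f) $ z\<bar> \<le> (\<Sum>y\<in>UNIV. \<bar>f $ y\<bar>)" if "T \<in> \<S>" for T
    using transition_matrix_on_abs_mult_le assms[OF that] .
  show "bdd_above ((\<lambda>T. (T *v f) $ z) ` \<S>)"
    by (rule bdd_aboveI[where M = "\<Sum>y\<in>UNIV. \<bar>f $ y\<bar>"]) (use b in force)
  show "bdd_below ((\<lambda>T. (T *v f) $ z) ` \<S>)"
    by (rule bdd_belowI[where m = "- (\<Sum>y\<in>UNIV. \<bar>f $ y\<bar>)"]) (use b in force)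
qed

lemma lower_op_le_mult:
  assumes "\<And>T. T \<in> \<S> \<Longrightarrow> transition_matrix_on W T" "T \<in> \<S>"
  shows "lower_op \<S> f $ z \<le> (T *v f) $ z"
  unfolding lower_op_def vec_lambda_beta
  by (rule cINF_lower[OF bdd_mult_transition_matrices(2)[OF assms(1)] assms(2)])

lemma mult_le_upper_op:
  assumes "\<And>T. T \<in> \<S> \<Longrightarrow> transition_matrix_on W T" "T \<in> \<S>"
  shows "(T *v f) $ z \<le> upper_op \<S> f $ z"
  unfolding upper_op_def vec_lambda_beta
  by (rule cSUP_upper[OF assms(2) bdd_mult_transition_matrices(1)[OF assms(1)]])

lemma le_lower_opI:
  assumes "\<S> \<noteq> {}" "\<And>T. T \<in> \<S> \<Longrightarrow> c \<le> (T *v f) $ z"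
  shows "c \<le> lower_op \<S> f $ z"
  unfolding lower_op_def vec_lambda_beta using assms by (rule cINF_greatest)

lemma restrict_matrix_mult:
  assumes "z \<in> W" "\<And>y. y \<notin> W \<Longrightarrow> T $ z $ y = 0" "\<And>y. y \<in> W \<Longrightarrow> f $ y = g $ y"
  shows "(restrict_matrix W T *v f) $ z = (T *v g) $ z"
  unfolding matrix_vector_mult_def vec_lambda_beta restrict_matrix_def
  by (rule sum.cong) (use assms in auto)

lemma linear_restrict_matrix: "linear (restrict_matrix W)"
  by (rule linearI) (auto simp: restrict_matrix_def vec_eq_iff)

lemma hitting_equation_iff:
  "h = ind (W - A) + ind (W - A) * (T *v h) \<longleftrightarrow>
    (\<forall>z. h $ z = (if z \<in> W - A then 1 + (T *v h) $ z else 0))"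
  by (auto simp: vec_eq_iff ind_def indicator_def)


section \<open>The maximum principle\<close>

locale reachable_target =
  fixes \<S> :: "(real ^ 'z ^ 'z::finite) set" and W A :: "'z set"
  assumes trans: "\<And>T. T \<in> \<S> \<Longrightarrow> transition_matrix_on W T"
    and nonempty: "\<S> \<noteq> {}"
    and target: "A \<subseteq> W"
    and target_closed: "\<And>T x y. T \<in> \<S> \<Longrightarrow> x \<in> A \<Longrightarrow> y \<notin> A \<Longrightarrow> T $ x $ y = 0"
    and reach: "\<And>z. z \<in> W - A \<Longrightarrow> lower_reachable \<S> A z"
begin

text \<open>If \<open>d\<close> had a positive maximum on \<open>W\<close>, the maximisers would form a set disjoint from \<open>A\<close>
  that \<open>T\<close> cannot leave, contradicting lower reachability.\<close>

lemma maximum_principle: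
  assumes T: "T \<in> \<S>"
    and sub: "\<And>z. z \<in> W - A \<Longrightarrow> d $ z \<le> (T *v d) $ z"
    and A: "\<And>z. z \<in> A \<Longrightarrow> d $ z \<le> 0"
    and z: "z \<in> W"
  shows "d $ z \<le> 0"
proof (rule ccontr)
  assume pos: "\<not> d $ z \<le> 0"
  define m where "m = Max ((\<lambda>y. d $ y) ` W)"
  have le_m: "d $ y \<le> m" if "y \<in> W" for y
    unfolding m_def using that by simp
  have "m \<in> (\<lambda>y. d $ y) ` W"
    unfolding m_def using z by (intro Max_in) auto
  then obtain x where x: "x \<in> W" "d $ x = m" by auto
  have m: "m > 0" using le_m[OF z] pos by linarith
  define M where "M = {y \<in> W. d $ y = m}"
  have MA: "y \<in> W - A" if "y \<in> M" for y
    using that A[of y] m by (auto simp: M_def)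
  have stay: "T $ y $ y' = 0" if y: "y \<in> M" and y': "y' \<notin> M" for y y'
  proof -
    have yW: "y \<in> W" and dy: "d $ y = m" using y by (auto simp: M_def)
    have nn: "0 \<le> T $ y $ u * (m - d $ u)" for u
      using le_m[of u] transition_matrix_on_nonneg[OF trans[OF T], of y u]
        transition_matrix_on_outside[OF trans[OF T], of y u]
      by (cases "u \<in> W") auto
    \<comment> \<open>Row sum 1 turns \<open>d $ y \<le> (T *v d) $ y\<close> at a maximiser into a
      nonpositive sum of nonnegative terms, so every term vanishes.\<close>
    have "(\<Sum>u\<in>UNIV. T $ y $ u * (m - d $ u)) = m - (T *v d) $ y"
      using transition_matrix_on_row_sum[OF trans[OF T] yW]
      by (simp add: matrix_vector_mult_def right_diff_distrib sum_subtractf flip: sum_distrib_right)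
    also have "\<dots> \<le> 0" using sub[OF MA[OF y]] dy by simp
    finally have "(\<Sum>u\<in>UNIV. T $ y $ u * (m - d $ u)) = 0"
      by (intro antisym sum_nonneg nn)
    then have "T $ y $ y' * (m - d $ y') = 0"
      using nn by (simp add: sum_nonneg_eq_0_iff)
    then show ?thesis
      using y' transition_matrix_on_outside[OF trans[OF T], of y y'] by (auto simp: M_def)
  qed
  have low: "(lower_op \<S> ^^ n) (ind A) $ y \<le> 0" if "y \<in> M" for n y
    using that
  proof (induction n arbitrary: y)
    case 0
    then show ?case using MA[of y] by (simp add: ind_def)
  next
    case (Suc n)
    have "(lower_op \<S> ^^ Suc n) (ind A) $ y \<le> (T *v (lower_op \<S> ^^ n) (ind A)) $ y"
      using lower_op_le_mult[OF trans T] by simp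
    also have "\<dots> \<le> 0"
      unfolding matrix_vector_mult_def vec_lambda_beta
    proof (rule sum_nonpos)
      fix u
      show "T $ y $ u * (lower_op \<S> ^^ n) (ind A) $ u \<le> 0"
        using Suc.IH[of u] stay[OF Suc.prems, of u] transition_matrix_on_nonneg[OF trans[OF T], of y u]
        by (cases "u \<in> M") (auto intro: mult_nonneg_nonpos)
    qed
    finally show ?case .
  qed
  have "x \<in> M" using x by (simp add: M_def)
  then show False
    using reach[OF MA] low[of x] by (force simp: lower_reachable_def not_le[symmetric])
qed

text \<open>The maximum principle, applied to \<open>d\<close> and \<open>-d\<close>, makes the
  homogeneous system injective; in finite dimension it is then also surjective.\<close>

lemma hitting_equation_unique_solution:
  assumes T: "T \<in> \<S>"
  shows "\<exists>!h. h = ind (W - A) + ind (W - A) * (T *v h)"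
proof -
  define L where "L = (\<lambda>d. d - ind (W - A) * (T *v d))"
  have lin: "linear L"
    unfolding L_def
    by (rule linearI) (auto simp: vec_eq_iff matrix_vector_right_distrib matrix_vector_mult_scaleR
        algebra_simps)
  have "d = 0" if "L d = 0" for d
  proof -
    have d: "d $ z = (if z \<in> W - A then (T *v d) $ z else 0)" for z
      using that unfolding L_def by (auto simp: vec_eq_iff ind_def indicator_def)
    have "d $ z \<le> 0" if "z \<in> W" for z
      by (rule maximum_principle[OF T _ _ that]) (auto simp: d[of z for z])
    moreover have "(-d) $ z \<le> 0" if "z \<in> W" for z
    proof (rule maximum_principle[OF T _ _ that])
      show "(- d) $ x \<le> (T *v - d) $ x" if "x \<in> W - A" for x
        using d[of x] that matrix_vector_mult_diff_distrib[of T 0 d] by simp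
      show "(- d) $ x \<le> 0" if "x \<in> A" for x using d[of x] that by simp
    qed
    ultimately have "d $ z = 0" for z using d[of z] by (cases "z \<in> W") force+
    then show ?thesis by (simp add: vec_eq_iff)
  qed
  then have inj: "inj L" using linear_injective_0[OF lin] by blast
  then have "surj L" using linear_injective_imp_surjective[OF lin] by blast
  then obtain h where h: "L h = ind (W - A)" by (metis surjD)
  have eq: "g = ind (W - A) + ind (W - A) * (T *v g) \<longleftrightarrow> L g = ind (W - A)" for g
    unfolding L_def by (auto simp: algebra_simps)
  show ?thesis
    unfolding eq using h inj by (metis injD)
qed

text \<open>The constant 1 cancels in \<open>h - v\<close>, which leaves exactly the hypotheses of
  the maximum principle. This is the source of all upper bounds on solutions: the uniform bound on
  the iterates and their domination by the limit.\<close>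

lemma hitting_solution_le_supersolution:
  assumes T: "T \<in> \<S>" and h: "h = ind (W - A) + ind (W - A) * (T *v h)"
    and v: "\<And>z. z \<in> W - A \<Longrightarrow> 1 + (T *v v) $ z \<le> v $ z" "\<And>z. z \<in> A \<Longrightarrow> 0 \<le> v $ z"
    and z: "z \<in> W"
  shows "h $ z \<le> v $ z"
proof -
  note h' = h[unfolded hitting_equation_iff, rule_format]
  have "(h - v) $ z \<le> 0"
  proof (rule maximum_principle[OF T _ _ z])
    show "(h - v) $ x \<le> (T *v (h - v)) $ x" if "x \<in> W - A" for x
      using h'[of x] v(1)[OF that] that by (simp add: matrix_vector_mult_diff_distrib)
    show "(h - v) $ x \<le> 0" if "x \<in> A" for x using h'[of x] v(2)[OF that] that by simp
  qed
  then show ?thesis by simp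
qed

text \<open>The mirror image, with \<open>v - h\<close>. It yields monotonicity of the iteration,
  since each iterate is a subsolution for the next matrix.\<close>

lemma subsolution_le_hitting_solution:
  assumes T: "T \<in> \<S>" and h: "h = ind (W - A) + ind (W - A) * (T *v h)"
    and v: "\<And>z. z \<in> W - A \<Longrightarrow> v $ z \<le> 1 + (T *v v) $ z" "\<And>z. z \<in> A \<Longrightarrow> v $ z \<le> 0"
    and z: "z \<in> W"
  shows "v $ z \<le> h $ z"
proof -
  note h' = h[unfolded hitting_equation_iff, rule_format]
  have "(v - h) $ z \<le> 0"
  proof (rule maximum_principle[OF T _ _ z])
    show "(v - h) $ x \<le> (T *v (v - h)) $ x" if "x \<in> W - A" for x
      using h'[of x] v(1)[OF that] that by (simp add: matrix_vector_mult_diff_distrib)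
    show "(v - h) $ x \<le> 0" if "x \<in> A" for x using h'[of x] v(2)[OF that] that by simp
  qed
  then show ?thesis by simp
qed

lemma hitting_solution_nonneg:
  assumes "T \<in> \<S>" "h = ind (W - A) + ind (W - A) * (T *v h)"
  shows "0 \<le> h $ z"
  using subsolution_le_hitting_solution[OF assms, of 0 z]
    assms(2)[unfolded hitting_equation_iff, rule_format, of z]
  by (cases "z \<in> W") auto

lemma lower_op_power_bounds:
  "0 \<le> (lower_op \<S> ^^ n) (ind A) $ z \<and> (lower_op \<S> ^^ n) (ind A) $ z \<le> 1"
proof (induction n arbitrary: z)
  case 0
  show ?case by (auto simp: ind_def indicator_def)
next
  case (Suc n)
  let ?g = "(lower_op \<S> ^^ n) (ind A)"
  have "0 \<le> lower_op \<S> ?g $ z"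
    using Suc.IH by (intro le_lower_opI[OF nonempty] transition_matrix_on_mult_nonneg[OF trans]) auto
  moreover have "lower_op \<S> ?g $ z \<le> 1"
  proof -
    obtain T where T: "T \<in> \<S>" using nonempty by blast
    have "lower_op \<S> ?g $ z \<le> (T *v ?g) $ z" by (rule lower_op_le_mult[OF trans T])
    also have "\<dots> \<le> (T *v 1) $ z"
      by (rule transition_matrix_on_mult_mono[OF trans[OF T]]) (use Suc.IH in auto)
    also have "\<dots> \<le> 1"
      using transition_matrix_on_row_sum_le_1[OF trans[OF T]] by (simp add: matrix_vector_mult_def)
    finally show ?thesis .
  qed
  ultimately show ?case by simp
qed

text \<open>Closedness of \<open>A\<close> keeps all mass of a row of \<open>A\<close> inside
  \<open>A\<close>, which gives the first inequality; monotonicity of the operator propagates it.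
  The gain is that one exponent can later serve all states.\<close>

lemma lower_op_power_Suc_ge:
  "(lower_op \<S> ^^ n) (ind A) $ z \<le> (lower_op \<S> ^^ Suc n) (ind A) $ z"
proof (induction n arbitrary: z)
  case 0
  show ?case
  proof (cases "z \<in> A")
    case True
    have "1 \<le> (T *v ind A) $ z" if T: "T \<in> \<S>" for T
    proof -
      have "(T *v ind A) $ z = (\<Sum>y\<in>UNIV. T $ z $ y)"
        unfolding matrix_vector_mult_def vec_lambda_beta
        by (rule sum.cong) (use target_closed[OF T True] in \<open>auto simp: ind_def indicator_def\<close>)
      then show ?thesis using transition_matrix_on_row_sum[OF trans[OF T]] True target by auto
    qed
    then show ?thesis using True by (auto simp: ind_def intro!: le_lower_opI[OF nonempty])
  next
    case False
    then show ?thesis using lower_op_power_bounds[of 1 z] by (simp add: ind_def)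
  qed
next
  case (Suc n)
  let ?g = "\<lambda>n. (lower_op \<S> ^^ n) (ind A)"
  have "lower_op \<S> (?g n) $ z \<le> (T *v ?g (Suc n)) $ z" if T: "T \<in> \<S>" for T
  proof -
    have "lower_op \<S> (?g n) $ z \<le> (T *v ?g n) $ z" by (rule lower_op_le_mult[OF trans T])
    also have "\<dots> \<le> (T *v ?g (Suc n)) $ z"
      by (rule transition_matrix_on_mult_mono[OF trans[OF T] Suc.IH])
    finally show ?thesis .
  qed
  then have "lower_op \<S> (?g n) $ z \<le> lower_op \<S> (?g (Suc n)) $ z"
    by (rule le_lower_opI[OF nonempty])
  then show ?case by simp
qed

lemma uniform_lower_reachability:
  "\<exists>k \<epsilon>. 0 < \<epsilon> \<and> (\<forall>z\<in>W. \<epsilon> \<le> (lower_op \<S> ^^ k) (ind A) $ z)"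
proof -
  let ?g = "\<lambda>n. (lower_op \<S> ^^ n) (ind A)"
  have mono: "?g m $ z \<le> ?g n $ z" if "m \<le> n" for m n z
    by (rule lift_Suc_mono_le[of "\<lambda>n. ?g n $ z", OF lower_op_power_Suc_ge that])
  have "\<forall>z\<in>W. \<exists>n. 0 < ?g n $ z"
  proof
    fix z assume "z \<in> W"
    show "\<exists>n. 0 < ?g n $ z"
    proof (cases "z \<in> A")
      case True
      then have "0 < ?g 0 $ z" by (simp add: ind_def)
      then show ?thesis by blast
    next
      case False
      then show ?thesis using reach \<open>z \<in> W\<close> unfolding lower_reachable_def by blast
    qed
  qed
  then obtain N where N: "\<And>z. z \<in> W \<Longrightarrow> 0 < ?g (N z) $ z" by metis
  define k where "k = Max (range N)"
  have pos: "0 < ?g k $ z" if "z \<in> W" for z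
    using N[OF that] mono[of "N z" k z] by (simp add: k_def)
  \<comment> \<open>The inserted 1 keeps \<open>Min\<close> meaningful when \<open>W\<close> is
    empty, a case that the locale allows.\<close>
  define \<epsilon> where "\<epsilon> = Min (insert 1 ((\<lambda>z. ?g k $ z) ` W))"
  have "0 < \<epsilon>" unfolding \<epsilon>_def using pos by (subst Min_gr_iff) auto
  moreover have "\<epsilon> \<le> ?g k $ z" if "z \<in> W" for z unfolding \<epsilon>_def using that by (intro Min_le) auto
  ultimately show ?thesis by blast
qed

text \<open>With \<open>g\<^sub>j\<close> the \<open>j\<close>-th power of the lower operator at the indicator of \<open>A\<close>, the sum
  \<open>\<Sum>j<k. 1 - g\<^sub>j\<close> telescopes: each \<open>T\<close> decreases it by at least \<open>g\<^sub>k - g\<^sub>0\<close>, which is bounded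
  away from zero on \<open>W - A\<close> for large \<open>k\<close>.\<close>

lemma common_supersolution:
  "\<exists>v. (\<forall>z. 0 \<le> v $ z) \<and> (\<forall>T\<in>\<S>. \<forall>z\<in>W - A. 1 + (T *v v) $ z \<le> v $ z)"
proof -
  let ?g = "\<lambda>n. (lower_op \<S> ^^ n) (ind A)"
  obtain k \<epsilon> where \<epsilon>: "0 < \<epsilon>" and k: "\<And>z. z \<in> W \<Longrightarrow> \<epsilon> \<le> ?g k $ z"
    using uniform_lower_reachability by blast
  \<comment> \<open>Division by \<open>\<epsilon>\<close> rescales the decrease of the sum to at
    least 1, the constant in the hitting equation.\<close>
  define v :: "real ^ 'z" where "v = (\<chi> z. (\<Sum>j<k. 1 - ?g j $ z) / \<epsilon>)"
  have "0 \<le> v $ z" for z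
    using \<epsilon> lower_op_power_bounds by (auto simp: v_def intro!: divide_nonneg_pos sum_nonneg)
  moreover have "1 + (T *v v) $ z \<le> v $ z" if T: "T \<in> \<S>" and z: "z \<in> W - A" for T z
  proof -
    have "(T *v v) $ z = (\<Sum>j<k. \<Sum>y\<in>UNIV. T $ z $ y * (1 - ?g j $ y)) / \<epsilon>"
      unfolding matrix_vector_mult_def v_def vec_lambda_beta
      by (simp add: sum_distrib_left sum_divide_distrib) (rule sum.swap)
    also have "\<dots> = (\<Sum>j<k. 1 - (T *v ?g j) $ z) / \<epsilon>"
      using transition_matrix_on_row_sum[OF trans[OF T], of z] z
      by (simp add: matrix_vector_mult_def right_diff_distrib sum_subtractf)
    also have "\<dots> \<le> (\<Sum>j<k. 1 - ?g (Suc j) $ z) / \<epsilon>"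
      using \<epsilon> lower_op_le_mult[OF trans T] by (intro divide_right_mono sum_mono) auto
    also have "(\<Sum>j<k. 1 - ?g (Suc j) $ z) = (\<Sum>j<k. 1 - ?g j $ z) - (?g k $ z - ?g 0 $ z)"
      by (induction k) auto
    also have "\<dots> \<le> (\<Sum>j<k. 1 - ?g j $ z) - \<epsilon>"
      using k[of z] z by (simp add: ind_def)
    finally show ?thesis using \<epsilon> by (simp add: v_def divide_right_mono diff_divide_distrib)
  qed
  ultimately show ?thesis by blast
qed

text \<open>The last conclusion is the optimality of the limit: it beats the solution for every
  matrix of the family, not only for those that the iteration selects.\<close>

lemma policy_iteration:
  assumes T: "\<And>n. n \<ge> 1 \<Longrightarrow> T n \<in> \<S>"
    and h: "\<And>n. n \<ge> 1 \<Longrightarrow> h n = ind (W - A) + ind (W - A) * (T n *v h n)"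
    and step: "\<And>n z. n \<ge> 1 \<Longrightarrow> z \<in> W \<Longrightarrow>
      (T (n + 1) *v h n) $ z = (SUP S\<in>\<S>. (S *v h n) $ z)"
  obtains u where "\<And>z. (\<lambda>n. h n $ z) \<longlonglongrightarrow> u $ z"
    "\<And>z. 0 \<le> u $ z"
    "\<And>S g z. S \<in> \<S> \<Longrightarrow> g = ind (W - A) + ind (W - A) * (S *v g) \<Longrightarrow> z \<in> W \<Longrightarrow> g $ z \<le> u $ z"
proof -
  note h' = h[unfolded hitting_equation_iff, rule_format]
  have improve: "(S *v h n) $ z \<le> (T (n + 1) *v h n) $ z"
    if "n \<ge> 1" "z \<in> W" "S \<in> \<S>" for n z S
    unfolding step[OF that(1,2)]
    by (rule cSUP_upper[OF that(3) bdd_mult_transition_matrices(1)[OF trans]])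
  have inc: "h n $ z \<le> h (n + 1) $ z" if n: "n \<ge> 1" for n z
  proof (cases "z \<in> W")
    case True
    show ?thesis
    proof (rule subsolution_le_hitting_solution[OF T h _ _ True])
      show "h n $ x \<le> 1 + (T (n + 1) *v h n) $ x" if "x \<in> W - A" for x
        using improve[OF n _ T[OF n], of x] h'[OF n, of x] that by auto
      show "h n $ x \<le> 0" if "x \<in> A" for x
        using h'[OF n, of x] that by auto
    qed simp_all
  next
    case False
    then show ?thesis using h'[OF n, of z] h'[of "n + 1" z] by simp
  qed
  obtain v where v: "\<And>z. 0 \<le> v $ z" "\<And>S z. S \<in> \<S> \<Longrightarrow> z \<in> W - A \<Longrightarrow> 1 + (S *v v) $ z \<le> v $ z"
    using common_supersolution by blast
  have bound: "h n $ z \<le> v $ z" if n: "n \<ge> 1" for n z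
  proof (cases "z \<in> W")
    case True
    show ?thesis
      by (rule hitting_solution_le_supersolution[OF T h _ _ True]) (use n v T in auto)
  next
    case False
    then show ?thesis using h'[OF n, of z] v(1)[of z] by simp
  qed
  have "\<exists>l. (\<lambda>n. h n $ z) \<longlonglongrightarrow> l" for z
  proof -
    \<comment> \<open>The iteration starts at index 1 and \<open>h 0\<close> is arbitrary, hence the
      shift.\<close>
    have "incseq (\<lambda>n. h (Suc n) $ z)" using inc by (intro incseq_SucI) simp
    then have "convergent (\<lambda>n. h (Suc n) $ z)"
      using bound[of "Suc n" z for n] by (metis incseq_convergent convergentI Suc_le_mono le0 One_nat_def)
    then obtain l where "(\<lambda>n. h (Suc n) $ z) \<longlonglongrightarrow> l" unfolding convergent_def by blast
    then show ?thesis using LIMSEQ_imp_Suc[of "\<lambda>n. h n $ z"] by blast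
  qed
  then obtain l where l: "\<And>z. (\<lambda>n. h n $ z) \<longlonglongrightarrow> l z" by metis
  define u where "u = (\<chi> z. l z)"
  have u: "(\<lambda>n. h n $ z) \<longlonglongrightarrow> u $ z" for z using l by (simp add: u_def)
  have u0: "0 \<le> u $ z" for z
    by (rule LIMSEQ_le_const[OF u]) (use hitting_solution_nonneg[OF T h] in blast)
  have super: "1 + (S *v u) $ z \<le> u $ z" if S: "S \<in> \<S>" and z: "z \<in> W - A" for S z
  proof (rule LIMSEQ_le)
    show "(\<lambda>n. 1 + (S *v h n) $ z) \<longlonglongrightarrow> 1 + (S *v u) $ z"
      unfolding matrix_vector_mult_def vec_lambda_beta by (intro tendsto_intros u)
    show "(\<lambda>n. h (Suc n) $ z) \<longlonglongrightarrow> u $ z" by (rule LIMSEQ_Suc[OF u])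
    \<comment> \<open>The choice of \<open>T (n + 1)\<close> compares it with \<open>S\<close> at
      \<open>h n\<close>; replacing \<open>h n\<close> by the larger \<open>h (n + 1)\<close> then
      produces the right-hand side of the hitting equation for \<open>h (n + 1)\<close>.\<close>
    have "1 + (S *v h n) $ z \<le> h (Suc n) $ z" if n: "n \<ge> 1" for n
    proof -
      have "(S *v h n) $ z \<le> (T (n + 1) *v h n) $ z" using improve[OF n _ S] z by blast
      also have "\<dots> \<le> (T (n + 1) *v h (n + 1)) $ z"
        by (rule transition_matrix_on_mult_mono[OF trans[OF T]]) (use inc[OF n] in simp_all)
      finally show ?thesis using h'[of "Suc n" z] z by simp
    qed
    then show "\<exists>N. \<forall>n\<ge>N. 1 + (S *v h n) $ z \<le> h (Suc n) $ z" by blast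
  qed
  show ?thesis
    by (rule that[OF u u0]) (use hitting_solution_le_supersolution super u0 in blast)
qed

text \<open>This is the Neumann series of the hitting equation for the matrix killed outside
  \<open>W - A\<close>. Its partial sums stay below \<open>h\<close>, so it converges; its sum
  solves the equation and equals \<open>h\<close> by uniqueness.\<close>

lemma killed_chain_sums_hitting_solution:
  assumes T: "T \<in> \<S>" and h: "h = ind (W - A) + ind (W - A) * (T *v h)"
  shows "(\<lambda>n. (((\<lambda>f. ind (W - A) * (T *v f)) ^^ n) (ind (W - A))) $ z) sums h $ z"
proof -
  note h' = h[unfolded hitting_equation_iff, rule_format]
  define w where "w = (\<lambda>n. ((\<lambda>f. ind (W - A) * (T *v f)) ^^ n) (ind (W - A)))"
  have w0: "w 0 $ z = (if z \<in> W - A then 1 else 0)" for z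
    by (simp add: w_def ind_def indicator_def)
  have wS: "w (Suc n) $ z = (if z \<in> W - A then (T *v w n) $ z else 0)" for n z
    by (simp add: w_def ind_def indicator_def)
  have nn: "0 \<le> w n $ z" for n z
    by (induction n arbitrary: z) (auto simp: w0 wS intro!: transition_matrix_on_mult_nonneg[OF trans[OF T]])
  have le: "(\<Sum>n<N. w n) $ z \<le> h $ z" for N z
  proof (induction N arbitrary: z)
    case 0
    show ?case using hitting_solution_nonneg[OF T h] by simp
  next
    case (Suc N)
    \<comment> \<open>Splitting off the term at 0 exhibits the longer partial sum as the right-hand
      side of the hitting equation at the shorter one.\<close>
    have "(\<Sum>n<Suc N. w n) $ z = w 0 $ z + (\<Sum>n<N. w (Suc n) $ z)"
      by (subst sum.lessThan_Suc_shift) simp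
    also have "\<dots> = (if z \<in> W - A then 1 + (T *v (\<Sum>n<N. w n)) $ z else 0)"
      unfolding w0 wS
      by (simp add: matrix_vector_mult_def sum_distrib_left) (auto intro: sum.swap)
    also have "\<dots> \<le> h $ z"
      using transition_matrix_on_mult_mono[OF trans[OF T], of "\<Sum>n<N. w n" h z] Suc.IH h'[of z] by auto
    finally show ?case .
  qed
  have summ: "summable (\<lambda>n. w n $ z)" for z
    by (rule summableI_nonneg_bounded[OF nn]) (use le[of _ z] in simp)
  define u :: "real ^ 'z" where "u = (\<chi> z. \<Sum>n. w n $ z)"
  have u: "(\<lambda>n. w n $ z) sums u $ z" for z using summable_sums[OF summ] by (simp add: u_def)
  have "u $ z = (if z \<in> W - A then 1 + (T *v u) $ z else 0)" for z
  proof -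
    have "(\<lambda>n. (T *v w n) $ z) sums (T *v u) $ z"
      unfolding matrix_vector_mult_def vec_lambda_beta by (intro sums_sum sums_mult u)
    then have "(\<lambda>n. w (Suc n) $ z) sums (if z \<in> W - A then (T *v u) $ z else 0)"
      unfolding wS by auto
    from sums_Suc[of "\<lambda>n. w n $ z", OF this]
    have "(\<lambda>n. w n $ z) sums (if z \<in> W - A then 1 + (T *v u) $ z else 0)"
      unfolding w0 by (cases "z \<in> W - A") (auto simp: add.commute)
    then show ?thesis using u sums_unique2 by blast
  qed
  then have "u = h"
    using hitting_equation_unique_solution[OF T] h unfolding hitting_equation_iff by blast
  then show ?thesis using u by (simp add: w_def)
qed

end


section \<open>Expected hitting times\<close>

lemma sets_markov_chain:
  fixes T :: "real ^ 'z ^ 'z::finite"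
  shows "sets (markov_chain T z) = sets (PiM UNIV (\<lambda>_. count_space UNIV))"
proof -
  interpret IT: Ionescu_Tulcea "step_kernel T z" "\<lambda>_. count_space (UNIV :: 'z set)"
    by (rule Ionescu_Tulcea_step_kernel)
  show ?thesis unfolding markov_chain_def by (rule IT.PF.sets_lim)
qed

lemma sets_markov_chain_Collect_all:
  fixes P :: "nat \<Rightarrow> 'z::finite \<Rightarrow> bool"
  shows "{\<omega>. \<forall>i. P i (\<omega> i)} \<in> sets (markov_chain T z)"
proof -
  have "{\<omega>. \<forall>i. P i (\<omega> i)} = Pi\<^sub>E UNIV (\<lambda>i. {a. P i a})" by (auto simp: PiE_UNIV_domain)
  then show ?thesis unfolding sets_markov_chain by (auto intro: sets_PiM_I_countable)
qed

text \<open>The probability of avoiding \<open>A\<close> at times 1 to \<open>k\<close> when started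
  at \<open>x\<close>, by conditioning on the first step. Time 0 is left unconstrained, so
  \<open>x\<close> may lie in \<open>A\<close>.\<close>

fun avoiding_prob :: "real ^ 'z ^ 'z::finite \<Rightarrow> 'z set \<Rightarrow> nat \<Rightarrow> 'z \<Rightarrow> real" where
  "avoiding_prob T A 0 x = 1"
| "avoiding_prob T A (Suc k) x = (\<Sum>y\<in>-A. T $ x $ y * avoiding_prob T A k y)"

lemma avoiding_prob_nonneg:
  assumes "transition_matrix T"
  shows "0 \<le> avoiding_prob T A k x"
  by (induction k arbitrary: x)
    (auto intro!: sum_nonneg mult_nonneg_nonneg transition_matrix_on_nonneg[OF assms])

text \<open>Prescribing an arbitrary initial path replaces the Markov property: the induction on
  \<open>k\<close> lengthens the path by one state outside \<open>A\<close> until only the known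
  probability of a cylinder remains.\<close>

lemma emeasure_markov_chain_avoiding_after:
  fixes T :: "real ^ 'z ^ 'z::finite"
  assumes T: "transition_matrix T"
  shows "emeasure (markov_chain T z)
      {\<omega>. (\<forall>i\<le>m. \<omega> i = x i) \<and> (\<forall>i. m < i \<and> i \<le> m + k \<longrightarrow> \<omega> i \<notin> A)} =
    (if x 0 = z then ennreal ((\<Prod>i<m. T $ x i $ x (Suc i)) * avoiding_prob T A k (x m)) else 0)"
proof (induction k arbitrary: m x)
  case 0
  have "{\<omega>. (\<forall>i\<le>m. \<omega> i = x i) \<and> (\<forall>i. m < i \<and> i \<le> m + 0 \<longrightarrow> \<omega> i \<notin> A)} = {\<omega>. \<forall>i\<le>m. \<omega> i = x i}"
    by auto
  then show ?case using emeasure_markov_chain[OF T, of z m x] by simp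
next
  case (Suc k)
  let ?M = "markov_chain T z"
  define E where "E = (\<lambda>(m :: nat) k (x :: nat \<Rightarrow> 'z). {\<omega>. (\<forall>i\<le>m. \<omega> i = x i) \<and> (\<forall>i. m < i \<and> i \<le> m + k \<longrightarrow> \<omega> i \<notin> A)})"
  let ?x = "\<lambda>y. x(Suc m := y)"
  have step: "\<omega> \<in> E m (Suc k) x \<longleftrightarrow> \<omega> (Suc m) \<notin> A \<and> \<omega> \<in> E (Suc m) k (?x (\<omega> (Suc m)))" for \<omega>
  proof -
    have "m < i \<and> i \<le> m + Suc k \<longleftrightarrow> i = Suc m \<or> Suc m < i \<and> i \<le> Suc m + k" for i by auto
    then have "(\<forall>i. m < i \<and> i \<le> m + Suc k \<longrightarrow> \<omega> i \<notin> A) \<longleftrightarrow>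
        \<omega> (Suc m) \<notin> A \<and> (\<forall>i. Suc m < i \<and> i \<le> Suc m + k \<longrightarrow> \<omega> i \<notin> A)"
      by (simp only: imp_disjL all_conj_distrib simp_thms)
    moreover have "(\<forall>i\<le>m. \<omega> i = x i) \<longleftrightarrow> (\<forall>i\<le>Suc m. \<omega> i = ?x (\<omega> (Suc m)) i)"
      by (auto simp: le_Suc_eq)
    ultimately show ?thesis unfolding E_def mem_Collect_eq by argo
  qed
  have coord: "\<omega> (Suc m) = y" if "\<omega> \<in> E (Suc m) k (?x y)" for \<omega> y
    using that unfolding E_def by simp
  \<comment> \<open>The event is partitioned by the state at time \<open>Suc m\<close>.\<close>
  have E: "E m (Suc k) x = (\<Union>y\<in>-A. E (Suc m) k (?x y))"
    using step coord by blast
  have disj: "disjoint_family_on (\<lambda>y. E (Suc m) k (?x y)) (-A)"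
    unfolding disjoint_family_on_def using coord by blast
  have meas: "E m k x \<in> sets ?M" for m k x
  proof -
    have "E m k x = {\<omega>. \<forall>i. (i \<le> m \<longrightarrow> \<omega> i = x i) \<and> (m < i \<and> i \<le> m + k \<longrightarrow> \<omega> i \<notin> A)}"
      unfolding E_def by blast
    also have "\<dots> \<in> sets ?M" by (rule sets_markov_chain_Collect_all)
    finally show ?thesis .
  qed
  have IH: "emeasure ?M (E (Suc m) k (?x y)) = (if x 0 = z then
      ennreal ((\<Prod>i<m. T $ x i $ x (Suc i)) * (T $ x m $ y * avoiding_prob T A k y)) else 0)" for y
    using Suc.IH[of "Suc m" "?x y"] by (simp add: E_def mult.assoc)
  have "emeasure ?M (E m (Suc k) x) = (\<Sum>y\<in>-A. emeasure ?M (E (Suc m) k (?x y)))"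
    unfolding E by (rule sum_emeasure[symmetric]) (use disj meas in auto)
  also have "\<dots> = (\<Sum>y\<in>-A. if x 0 = z then
      ennreal ((\<Prod>i<m. T $ x i $ x (Suc i)) * (T $ x m $ y * avoiding_prob T A k y)) else 0)"
    by (simp only: IH)
  also have "\<dots> = (if x 0 = z then
      ennreal ((\<Prod>i<m. T $ x i $ x (Suc i)) * avoiding_prob T A (Suc k) (x m)) else 0)"
    using transition_matrix_on_nonneg[OF T] avoiding_prob_nonneg[OF T]
    by (auto simp: sum_distrib_left intro!: sum_ennreal prod_nonneg mult_nonneg_nonneg)
  finally show ?case unfolding E_def .
qed

lemma emeasure_markov_chain_avoiding:
  fixes T :: "real ^ 'z ^ 'z::finite"
  assumes T: "transition_matrix T"
  shows "emeasure (markov_chain T z) {\<omega>. \<forall>i\<le>n. \<omega> i \<notin> A} =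
    (if z \<in> A then 0 else ennreal (avoiding_prob T A n z))"
proof -
  let ?M = "markov_chain T z"
  define E where "E = (\<lambda>y. {\<omega> :: nat \<Rightarrow> 'z. (\<forall>i\<le>0. \<omega> i = y) \<and> (\<forall>i. 0 < i \<and> i \<le> 0 + n \<longrightarrow> \<omega> i \<notin> A)})"
  define Q where "Q = (\<lambda>\<omega> :: nat \<Rightarrow> 'z. \<forall>i. 0 < i \<and> i \<le> n \<longrightarrow> \<omega> i \<notin> A)"
  have mem_E: "\<omega> \<in> E y \<longleftrightarrow> \<omega> 0 = y \<and> Q \<omega>" for \<omega> y
    unfolding E_def Q_def by simp
  have split: "i \<le> n \<longleftrightarrow> i = 0 \<or> 0 < i \<and> i \<le> n" for i by auto
  have "(\<forall>i\<le>n. \<omega> i \<notin> A) \<longleftrightarrow> \<omega> 0 \<notin> A \<and> Q \<omega>" for \<omega>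
    unfolding Q_def by (subst split) (simp only: imp_disjL all_conj_distrib simp_thms)
  then have un: "{\<omega>. \<forall>i\<le>n. \<omega> i \<notin> A} = (\<Union>y\<in>-A. E y)"
    unfolding set_eq_iff mem_Collect_eq UN_iff mem_E by blast
  have disj: "disjoint_family_on E (-A)"
    unfolding disjoint_family_on_def using mem_E by (auto simp: set_eq_iff)
  have meas: "E y \<in> sets ?M" for y
  proof -
    have "E y = {\<omega>. \<forall>i. (i = 0 \<longrightarrow> \<omega> i = y) \<and> (0 < i \<and> i \<le> n \<longrightarrow> \<omega> i \<notin> A)}"
      unfolding set_eq_iff mem_E Q_def by blast
    also have "\<dots> \<in> sets ?M" by (rule sets_markov_chain_Collect_all)
    finally show ?thesis .
  qed
  have E: "emeasure ?M (E y) = (if y = z then ennreal (avoiding_prob T A n z) else 0)" for y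
  proof -
    have "emeasure ?M (E y) =
        (if y = z then ennreal ((\<Prod>i<(0::nat). T $ y $ y) * avoiding_prob T A n y) else 0)"
      unfolding E_def by (rule emeasure_markov_chain_avoiding_after[OF T, of z 0 "\<lambda>_. y" n A])
    then show ?thesis by auto
  qed
  have "emeasure ?M {\<omega>. \<forall>i\<le>n. \<omega> i \<notin> A} = (\<Sum>y\<in>-A. emeasure ?M (E y))"
    unfolding un by (rule sum_emeasure[symmetric]) (use disj meas in auto)
  then show ?thesis unfolding E by (simp add: sum.delta)
qed

text \<open>The pointwise tail-sum formula: the series counts the times strictly before the first
  visit. Without a visit both sides are infinite.\<close>

lemma hitting_time_eq_suminf:
  "hitting_time A \<omega> = (\<Sum>n. indicator {\<omega>. \<forall>i\<le>n. \<omega> i \<notin> A} \<omega>)"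
proof (cases "\<exists>n. \<omega> n \<in> A")
  case True
  define N where "N = (LEAST n. \<omega> n \<in> A)"
  have N: "\<omega> N \<in> A" unfolding N_def using True by (rule LeastI_ex)
  have le: "N \<le> n" if "\<omega> n \<in> A" for n
    unfolding N_def using that by (rule Least_le)
  have "hitting_time A \<omega> = of_nat N"
    unfolding hitting_time_def using N le by (intro antisym INF_lower INF_greatest) auto
  moreover have "(\<forall>i\<le>n. \<omega> i \<notin> A) \<longleftrightarrow> n < N" for n
    using N le by (metis le_less_trans not_le)
  then have "(\<Sum>n. indicator {\<omega>. \<forall>i\<le>n. \<omega> i \<notin> A} \<omega>) = (\<Sum>n<N. 1 :: ennreal)"
    by (subst suminf_finite[of "{..<N}"]) (auto simp: indicator_def)
  ultimately show ?thesis by simp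
next
  case False
  then have "hitting_time A \<omega> = \<top>" by (simp add: hitting_time_def)
  moreover have "(\<Sum>n. indicator {\<omega>. \<forall>i\<le>n. \<omega> i \<notin> A} \<omega>) = (\<Sum>n. 1 :: ennreal)"
    using False by simp
  moreover have "(\<Sum>n. 1 :: ennreal) = \<top>"
    by (simp add: suminf_eq_SUP ennreal_SUP_of_nat_eq_top)
  ultimately show ?thesis by simp
qed

lemma expected_hitting_time_eq_suminf:
  fixes T :: "real ^ 'z ^ 'z::finite"
  assumes T: "transition_matrix T"
  shows "(\<integral>\<^sup>+\<omega>. hitting_time A \<omega> \<partial>markov_chain T z) =
    (\<Sum>n. if z \<in> A then 0 else ennreal (avoiding_prob T A n z))"
proof -
  let ?M = "markov_chain T z"
  have meas: "{\<omega>. \<forall>i\<le>n. \<omega> i \<notin> A} \<in> sets ?M" for n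
    using sets_markov_chain_Collect_all[of "\<lambda>i a. i \<le> n \<longrightarrow> a \<notin> A"] by simp
  have "(\<integral>\<^sup>+\<omega>. hitting_time A \<omega> \<partial>?M) = (\<Sum>n. \<integral>\<^sup>+\<omega>. indicator {\<omega>. \<forall>i\<le>n. \<omega> i \<notin> A} \<omega> \<partial>?M)"
    unfolding hitting_time_eq_suminf
    by (rule nn_integral_suminf) (rule borel_measurable_indicator[OF meas])
  also have "\<dots> = (\<Sum>n. if z \<in> A then 0 else ennreal (avoiding_prob T A n z))"
    unfolding nn_integral_indicator[OF meas] emeasure_markov_chain_avoiding[OF T] ..
  finally show ?thesis .
qed

text \<open>A chain started in \<open>W\<close> stays there, so the full and the restricted matrix
  give the same recursion. The case distinction on \<open>z\<close> restores the condition at time 0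
  that \<open>avoiding_prob\<close> omits.\<close>

lemma avoiding_prob_eq_killed_chain:
  fixes T :: "real ^ 'z ^ 'z::finite"
  assumes absorb: "\<And>x y. x \<in> W \<Longrightarrow> y \<notin> W \<Longrightarrow> T $ x $ y = 0" and z: "z \<in> W"
  shows "(if z \<in> A then 0 else avoiding_prob T A n z) =
    ((\<lambda>f. ind (W - A) * (restrict_matrix W T *v f)) ^^ n) (ind (W - A)) $ z"
  using z
proof (induction n arbitrary: z)
  case 0
  then show ?case by (simp add: ind_def)
next
  case (Suc n)
  let ?w = "((\<lambda>f. ind (W - A) * (restrict_matrix W T *v f)) ^^ n) (ind (W - A))"
  let ?s = "\<chi> y. if y \<in> A then 0 else avoiding_prob T A n y"
  have "(restrict_matrix W T *v ?w) $ z = (T *v ?s) $ z"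
    by (rule restrict_matrix_mult) (use absorb Suc in auto)
  also have "\<dots> = (\<Sum>y\<in>-A. T $ z $ y * avoiding_prob T A n y)"
    unfolding matrix_vector_mult_def vec_lambda_beta
    by (rule sum.mono_neutral_cong_right) auto
  finally show ?case using Suc.prems by (simp add: ind_def indicator_def)
qed

lemma (in reachable_target) expected_hitting_time_eq_solution:
  assumes T: "transition_matrix T" "restrict_matrix W T \<in> \<S>"
    and absorb: "\<And>x y. x \<in> W \<Longrightarrow> y \<notin> W \<Longrightarrow> T $ x $ y = 0"
    and h: "h = ind (W - A) + ind (W - A) * (restrict_matrix W T *v h)"
    and z: "z \<in> W"
  shows "(\<integral>\<^sup>+\<omega>. hitting_time A \<omega> \<partial>markov_chain T z) = ennreal (h $ z)"
proof -
  have "(if z \<in> A then 0 else avoiding_prob T A n z) =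
      ((\<lambda>f. ind (W - A) * (restrict_matrix W T *v f)) ^^ n) (ind (W - A)) $ z" for n
    by (rule avoiding_prob_eq_killed_chain[OF absorb z])
  with killed_chain_sums_hitting_solution[OF T(2) h, of z]
  have "(\<lambda>n. if z \<in> A then 0 else avoiding_prob T A n z) sums h $ z" by (simp only:)
  then have "(\<Sum>n. ennreal (if z \<in> A then 0 else avoiding_prob T A n z)) = ennreal (h $ z)"
    by (rule suminf_ennreal_eq[rotated]) (simp add: avoiding_prob_nonneg[OF T(1)])
  then show ?thesis
    unfolding expected_hitting_time_eq_suminf[OF T(1)] by (cases "z \<in> A") simp_all
qed


section \<open>Simultaneous row maximisers\<close>

lemma separately_specified_rows_swap:
  assumes "separately_specified_rows \<T>" "S \<in> \<T>" "T \<in> \<T>"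
  shows "(\<chi> i. if i = z then S $ i else T $ i) \<in> \<T>"
proof -
  obtain R where R: "\<T> = {T. transition_matrix T \<and> (\<forall>z. row z T \<in> R z)}"
    using assms(1) unfolding separately_specified_rows_def by blast
  let ?U = "\<chi> i. if i = z then S $ i else T $ i"
  have "row i ?U = (if i = z then row i S else row i T)" for i
    by (simp add: row_def vec_eq_iff)
  then show ?thesis
    using assms(2,3) unfolding R by (auto simp: transition_matrix_on_def)
qed

text \<open>The maximisers of the linear functional \<open>S \<mapsto> \<Sum>z\<in>W. (S *v h) $ z\<close> form an exposed
  face. Since rows can be exchanged separately, each of them maximises every summand.\<close>

lemma extreme_row_maximiser:
  fixes \<S> :: "(real ^ 'z ^ 'z::finite) set"
  assumes \<S>: "compact \<S>" "convex \<S>" "\<S> \<noteq> {}"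
    and swap: "\<And>S T z. S \<in> \<S> \<Longrightarrow> T \<in> \<S> \<Longrightarrow> (\<chi> i. if i = z then S $ i else T $ i) \<in> \<S>"
  shows "\<exists>T. T extreme_point_of \<S> \<and> (\<forall>z. (T *v h) $ z = (SUP S\<in>\<S>. (S *v h) $ z))"
proof -
  \<comment> \<open>With \<open>h\<close> in every row, the inner product with \<open>S\<close> sums
    all entries of \<open>S *v h\<close>.\<close>
  define a :: "real ^ 'z ^ 'z" where "a = (\<chi> i. h)"
  have a: "a \<bullet> S = (\<Sum>z\<in>UNIV. (S *v h) $ z)" for S
    by (simp add: a_def inner_vec_def matrix_vector_mult_def mult.commute)
  have "continuous_on \<S> (\<lambda>S. a \<bullet> S)" by (intro continuous_intros)
  from continuous_attains_sup[OF \<S>(1,3) this]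
  obtain M where M: "M \<in> \<S>" "\<And>S. S \<in> \<S> \<Longrightarrow> a \<bullet> S \<le> a \<bullet> M" by blast
  define F where "F = \<S> \<inter> {S. a \<bullet> S = a \<bullet> M}"
  have F: "F face_of \<S>"
    unfolding F_def by (rule face_of_Int_supporting_hyperplane_le[OF \<S>(2) M(2)])
  have "F \<noteq> {}" unfolding F_def using M(1) by blast
  then have "\<exists>T. T extreme_point_of F"
    using extreme_point_exists_convex[OF face_of_imp_compact[OF \<S>(2,1) F] face_of_imp_convex[OF F]]
    by blast
  then obtain T where T: "T extreme_point_of \<S>" "T \<in> F"
    using extreme_point_of_face[OF F] by blast
  have max: "(S *v h) $ z \<le> (T *v h) $ z" if S: "S \<in> \<S>" for S z
  proof -
    \<comment> \<open>\<open>U\<close> changes \<open>T\<close> in row \<open>z\<close> only, so the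
      comparison of the two total sums reduces to the entry at \<open>z\<close>.\<close>
    define U where "U = (\<chi> i. if i = z then S $ i else T $ i)"
    have U: "(U *v h) $ y = (if y = z then (S *v h) $ z else (T *v h) $ y)" for y
      by (simp add: U_def matrix_vector_mult_def)
    have "a \<bullet> U \<le> a \<bullet> T"
      using M(2)[of U] swap[OF S, of T z] T(2) by (simp add: F_def U_def)
    then have "(\<Sum>y\<in>UNIV. (U *v h) $ y) \<le> (\<Sum>y\<in>UNIV. (T *v h) $ y)" unfolding a .
    moreover have "(\<Sum>y\<in>UNIV - {z}. (U *v h) $ y) = (\<Sum>y\<in>UNIV - {z}. (T *v h) $ y)"
      by (rule sum.cong) (simp_all add: U)
    ultimately show ?thesis
      using sum.remove[of UNIV z "\<lambda>y. (U *v h) $ y"] sum.remove[of UNIV z "\<lambda>y. (T *v h) $ y"]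
      by (simp add: U)
  qed
  have "(T *v h) $ z = (SUP S\<in>\<S>. (S *v h) $ z)" for z
    by (rule cSup_eq_maximum[symmetric]) (use T(2) max in \<open>auto simp: F_def\<close>)
  then show ?thesis using T(1) by blast
qed


section \<open>The restriction to the good states\<close>

lemma upper_op_power_ind_nonneg:
  assumes "\<And>T. T \<in> \<T> \<Longrightarrow> transition_matrix T" "\<T> \<noteq> {}"
  shows "0 \<le> (upper_op \<T> ^^ n) (ind C) $ z"
proof (induction n arbitrary: z)
  case (Suc n)
  obtain T where T: "T \<in> \<T>" using assms(2) by blast
  have "0 \<le> (T *v (upper_op \<T> ^^ n) (ind C)) $ z"
    by (rule transition_matrix_on_mult_nonneg[OF assms(1)[OF T] Suc.IH])
  also have "\<dots> \<le> (upper_op \<T> ^^ Suc n) (ind C) $ z"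
    using mult_le_upper_op[OF assms(1) T] by simp
  finally show ?case .
qed (simp add: ind_def)

text \<open>Prepending one positive transition costs one power of the upper operator; as these
  powers are nonnegative, the other terms of the row cannot cancel the contribution of
  \<open>y\<close>. If \<open>y\<close> lies in \<open>C\<close>, power 0 is used for
  \<open>y\<close>, and the resulting exponent is still at least 1.\<close>

lemma upper_reachable_step:
  assumes trans: "\<And>T. T \<in> \<T> \<Longrightarrow> transition_matrix T" and T: "T \<in> \<T>" "0 < T $ x $ y"
    and y: "y \<in> C \<or> upper_reachable \<T> C y"
  shows "upper_reachable \<T> C x"
proof -
  let ?u = "\<lambda>n. (upper_op \<T> ^^ n) (ind C)"
  obtain n where n: "0 < ?u n $ y"
  proof (cases "y \<in> C")
    case True
    then have "0 < ?u 0 $ y" by (simp add: ind_def)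
    then show ?thesis by (rule that)
  qed (use y that in \<open>auto simp: upper_reachable_def\<close>)
  have nn: "0 \<le> ?u n $ v" for v
    using upper_op_power_ind_nonneg[OF trans] T(1) by blast
  have "0 < T $ x $ y * ?u n $ y" using T(2) n by simp
  also have "\<dots> \<le> (\<Sum>v\<in>UNIV. T $ x $ v * ?u n $ v)"
    by (rule member_le_sum) (use transition_matrix_on_nonneg[OF trans[OF T(1)]] nn in auto)
  also have "\<dots> = (T *v ?u n) $ x" by (simp add: matrix_vector_mult_def)
  also have "\<dots> \<le> ?u (Suc n) $ x" using mult_le_upper_op[OF trans T(1)] by simp
  finally show ?thesis unfolding upper_reachable_def by (metis le_add1 plus_1_eq_Suc)
qed

text \<open>A positive transition from outside \<open>A\<close> into a bad state would make
  \<open>not_lower_reaching\<close> upper reachable and the origin bad as well. From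
  \<open>A\<close>, closedness forbids it, since bad states lie outside \<open>A\<close>.\<close>

lemma not_bad_states_absorbing:
  assumes trans: "\<And>T. T \<in> \<T> \<Longrightarrow> transition_matrix T"
    and closed: "closed_target \<T> A" and T: "T \<in> \<T>"
    and x: "x \<notin> bad_states \<T> A" and y: "y \<in> bad_states \<T> A"
  shows "T $ x $ y = 0"
proof (cases "x \<in> A")
  case True
  have "y \<notin> A" using y by (auto simp: bad_states_def not_lower_reaching_def upper_reaching_bad_def)
  then show ?thesis using closed True T unfolding closed_target_def by blast
next
  case False
  then have "\<not> upper_reachable \<T> (not_lower_reaching \<T> A) x"
    using x by (auto simp: bad_states_def upper_reaching_bad_def)
  then have "\<not> 0 < T $ x $ y"
    using upper_reachable_step[OF trans T, of x y "not_lower_reaching \<T> A"] y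
    by (auto simp: bad_states_def upper_reaching_bad_def)
  then show ?thesis using transition_matrix_on_nonneg[OF trans[OF T], of x y] by simp
qed

text \<open>Rows of \<open>W\<close> charge only \<open>W\<close>, so values outside
  \<open>W\<close> never enter the recursion. This transfers lower reachability from the full family
  to the restricted one.\<close>

lemma lower_op_power_restrict:
  fixes \<T> :: "(real ^ 'z ^ 'z::finite) set"
  assumes "\<And>T x y. T \<in> \<T> \<Longrightarrow> x \<in> W \<Longrightarrow> y \<notin> W \<Longrightarrow> T $ x $ y = 0" "z \<in> W"
  shows "(lower_op (restrict_matrix W ` \<T>) ^^ n) f $ z = (lower_op \<T> ^^ n) f $ z"
  using assms(2)
proof (induction n arbitrary: z)
  case (Suc n)
  let ?g = "\<lambda>\<S>. (lower_op \<S> ^^ n) f"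
  have "(restrict_matrix W T *v ?g (restrict_matrix W ` \<T>)) $ z = (T *v ?g \<T>) $ z"
    if "T \<in> \<T>" for T
    by (rule restrict_matrix_mult) (use assms(1) that Suc in auto)
  then have "(INF T\<in>\<T>. (restrict_matrix W T *v ?g (restrict_matrix W ` \<T>)) $ z) =
      (INF T\<in>\<T>. (T *v ?g \<T>) $ z)"
    by (intro INF_cong) auto
  then have "lower_op (restrict_matrix W ` \<T>) (?g (restrict_matrix W ` \<T>)) $ z = lower_op \<T> (?g \<T>) $ z"
    unfolding lower_op_def vec_lambda_beta image_image .
  then show ?case by simp
qed simp

lemma transition_matrix_on_restrict:
  assumes T: "transition_matrix T" and absorb: "\<And>x y. x \<in> W \<Longrightarrow> y \<notin> W \<Longrightarrow> T $ x $ y = 0"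
  shows "transition_matrix_on W (restrict_matrix W T)"
proof -
  have "(\<Sum>y\<in>W. T $ x $ y) = 1" if "x \<in> W" for x
  proof -
    have "(\<Sum>y\<in>W. T $ x $ y) = (\<Sum>y\<in>UNIV. T $ x $ y)"
      by (rule sum.mono_neutral_left) (use absorb that in auto)
    then show ?thesis using transition_matrix_on_row_sum[OF T, of x] by simp
  qed
  then show ?thesis
    using transition_matrix_on_nonneg[OF T]
    by (auto simp: transition_matrix_on_def restrict_matrix_def cong: sum.cong)
qed


section \<open>Convergence of the policy iteration\<close>

text \<open>The clauses on existence and uniqueness keep the convergence clause from being vacuous:
  they supply a start, a solution of each linear system and an extreme maximiser for the next step.
  The limit is taken in \<open>ereal\<close> because the upper expected hitting time may a priori be
  infinite.\<close>

theorem mainTheorem2: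
  fixes \<T> :: "(real ^ 'z ^ 'z::finite) set" and A W :: "'z set"
    and \<T>W :: "(real ^ 'z ^ 'z) set"
  assumes "CARD('z) \<ge> 2"
    and "\<T> \<noteq> {}" and "compact \<T>" and "convex \<T>"
    and "\<forall>T\<in>\<T>. transition_matrix T"
    and "separately_specified_rows \<T>"
    and "closed_target \<T> A"
    and W: "W = UNIV - bad_states \<T> A" and "W \<noteq> {}"
    and \<T>W: "\<T>W = restrict_matrix W ` \<T>"
  shows
    \<comment> \<open>the restriction is a set of transition matrices on \<open>W\<close>, and \<open>A\<close> is lower reachable\<close>
    "(\<forall>T\<in>\<T>W. transition_matrix_on W T) \<and>
     (\<forall>z\<in>W - A. lower_reachable \<T>W A z) \<and>
     \<comment> \<open>the iteration is well defined\<close>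
     (\<exists>T. T extreme_point_of \<T>W) \<and>
     (\<forall>T. T extreme_point_of \<T>W \<longrightarrow>
        (\<exists>!h. h = ind (W - A) + ind (W - A) * (T *v h))) \<and>
     (\<forall>T h. T extreme_point_of \<T>W \<and> h = ind (W - A) + ind (W - A) * (T *v h) \<longrightarrow>
        (\<exists>T'. T' extreme_point_of \<T>W \<and>
          (\<forall>z\<in>W. (T' *v h) $ z = (SUP S\<in>\<T>W. (S *v h) $ z)))) \<and>
     \<comment> \<open>the iteration converges to the upper expected hitting time on \<open>W\<close>\<close>
     (\<forall>(T :: nat \<Rightarrow> real ^ 'z ^ 'z) (h :: nat \<Rightarrow> real ^ 'z).
        T 1 extreme_point_of \<T>W \<and>
        (\<forall>n\<ge>1. h n = ind (W - A) + ind (W - A) * (T n *v h n)) \<and>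
        (\<forall>n\<ge>1. T (n + 1) extreme_point_of \<T>W \<and>
           (\<forall>z\<in>W. (T (n + 1) *v h n) $ z = (SUP S\<in>\<T>W. (S *v h n) $ z))) \<longrightarrow>
        (\<forall>z\<in>W. (\<lambda>n. ereal (h n $ z)) \<longlonglongrightarrow>
           enn2ereal (upper_expected_hitting_time \<T> A z)))"
proof -
  have trans_T: "\<And>T. T \<in> \<T> \<Longrightarrow> transition_matrix T" using assms(5) by blast
  have absorb: "\<And>T x y. T \<in> \<T> \<Longrightarrow> x \<in> W \<Longrightarrow> y \<notin> W \<Longrightarrow> T $ x $ y = 0"
    using not_bad_states_absorbing[OF trans_T assms(7)] unfolding W by blast
  have transW: "transition_matrix_on W T" if "T \<in> \<T>W" for T
    using that transition_matrix_on_restrict trans_T absorb unfolding \<T>W by blast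
  have reachW: "lower_reachable \<T>W A z" if "z \<in> W - A" for z
  proof -
    have "lower_reachable \<T> A z"
      using that by (auto simp: W bad_states_def not_lower_reaching_def)
    then show ?thesis
      using lower_op_power_restrict[of \<T> W, OF absorb] that
      unfolding lower_reachable_def \<T>W by auto
  qed
  interpret reachable_target \<T>W W A
  proof
    show "A \<subseteq> W"
      by (auto simp: W bad_states_def not_lower_reaching_def upper_reaching_bad_def)
    show "T $ x $ y = 0" if "T \<in> \<T>W" "x \<in> A" "y \<notin> A" for T x y
      using that assms(7) by (auto simp: \<T>W restrict_matrix_def closed_target_def)
  qed (use transW reachW assms(2) \<T>W in auto)
  have "continuous_on \<T> (restrict_matrix W)"
    using linear_restrict_matrix unfolding linear_conv_bounded_linear by (rule linear_continuous_on)
  then have compactW: "compact \<T>W"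
    unfolding \<T>W using assms(3) by (rule compact_continuous_image)
  have convexW: "convex \<T>W"
    unfolding \<T>W using linear_restrict_matrix assms(4) by (rule convex_linear_image)
  have swapW: "(\<chi> i. if i = z then S $ i else T $ i) \<in> \<T>W" if ST: "S \<in> \<T>W" "T \<in> \<T>W" for S T z
  proof -
    obtain S' T' where *: "S' \<in> \<T>" "S = restrict_matrix W S'" "T' \<in> \<T>" "T = restrict_matrix W T'"
      using ST unfolding \<T>W by blast
    \<comment> \<open>Restriction acts row by row, so rows can be exchanged before
      restricting.\<close>
    have "(\<chi> i. if i = z then S $ i else T $ i) =
        restrict_matrix W (\<chi> i. if i = z then S' $ i else T' $ i)"
      by (auto simp: * restrict_matrix_def vec_eq_iff)
    then show ?thesis
      using separately_specified_rows_swap[OF assms(6) *(1,3)] unfolding \<T>W by blast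
  qed
  have maximiser: "\<exists>T. T extreme_point_of \<T>W \<and> (\<forall>z. (T *v h) $ z = (SUP S\<in>\<T>W. (S *v h) $ z))" for h
    by (rule extreme_row_maximiser[OF compactW convexW nonempty swapW])
  have extreme: "T \<in> \<T>W" if "T extreme_point_of \<T>W" for T
    using that by (simp add: extreme_point_of_def)
  have conv: "(\<lambda>n. ereal (h n $ z)) \<longlonglongrightarrow> enn2ereal (upper_expected_hitting_time \<T> A z)"
    if T1: "T 1 extreme_point_of \<T>W"
      and h: "\<forall>n\<ge>1. h n = ind (W - A) + ind (W - A) * (T n *v h n)"
      and step: "\<forall>n\<ge>1. T (n + 1) extreme_point_of \<T>W \<and>
           (\<forall>z\<in>W. (T (n + 1) *v h n) $ z = (SUP S\<in>\<T>W. (S *v h n) $ z))"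
      and z: "z \<in> W"
    for T :: "nat \<Rightarrow> real ^ 'z ^ 'z" and h z
  proof -
    have T: "T n \<in> \<T>W" if "n \<ge> 1" for n
    proof (cases "n = 1")
      case True
      then show ?thesis using T1 extreme by simp
    next
      case False
      then show ?thesis using step[rule_format, of "n - 1"] that extreme by simp
    qed
    have h': "\<And>n. n \<ge> 1 \<Longrightarrow> h n = ind (W - A) + ind (W - A) * (T n *v h n)"
      and step': "\<And>n z. n \<ge> 1 \<Longrightarrow> z \<in> W \<Longrightarrow> (T (n + 1) *v h n) $ z = (SUP S\<in>\<T>W. (S *v h n) $ z)"
      using h step by blast+
    obtain u where u: "\<And>z. (\<lambda>n. h n $ z) \<longlonglongrightarrow> u $ z" "\<And>z. 0 \<le> u $ z"
      "\<And>S g z. S \<in> \<T>W \<Longrightarrow> g = ind (W - A) + ind (W - A) * (S *v g) \<Longrightarrow> z \<in> W \<Longrightarrow> g $ z \<le> u $ z"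
      using policy_iteration[of T h, OF T h' step'] by blast
    have "upper_expected_hitting_time \<T> A z = ennreal (u $ z)"
    proof (rule antisym)
      show "upper_expected_hitting_time \<T> A z \<le> ennreal (u $ z)"
        unfolding upper_expected_hitting_time_def
      proof (rule SUP_least)
        fix S assume S: "S \<in> \<T>"
        then have SW: "restrict_matrix W S \<in> \<T>W" unfolding \<T>W by blast
        obtain g where g: "g = ind (W - A) + ind (W - A) * (restrict_matrix W S *v g)"
          using hitting_equation_unique_solution[OF SW] by blast
        have "(\<integral>\<^sup>+\<omega>. hitting_time A \<omega> \<partial>markov_chain S z) = ennreal (g $ z)"
          by (rule expected_hitting_time_eq_solution[OF trans_T[OF S] SW absorb[OF S] g z])
        also have "\<dots> \<le> ennreal (u $ z)" by (rule ennreal_leI[OF u(3)[OF SW g z]])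
        finally show "(\<integral>\<^sup>+\<omega>. hitting_time A \<omega> \<partial>markov_chain S z) \<le> ennreal (u $ z)" .
      qed
      have "ennreal (h n $ z) \<le> upper_expected_hitting_time \<T> A z" if n: "n \<ge> 1" for n
      proof -
        \<comment> \<open>A preimage of \<open>T n\<close> under restriction is a genuine transition
          matrix of the original family, and its chain realises \<open>h n\<close> as an expected
          hitting time.\<close>
        obtain S where S: "S \<in> \<T>" "T n = restrict_matrix W S" using T[OF n] unfolding \<T>W by blast
        have "ennreal (h n $ z) = (\<integral>\<^sup>+\<omega>. hitting_time A \<omega> \<partial>markov_chain S z)"
          by (rule expected_hitting_time_eq_solution
              [OF trans_T[OF S(1)] T[OF n, unfolded S(2)] absorb[OF S(1)] h'[OF n, unfolded S(2)] z,
                symmetric])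
        then show ?thesis
          unfolding upper_expected_hitting_time_def using S(1) by (auto intro: SUP_upper)
      qed
      moreover have "(\<lambda>n. ennreal (h n $ z)) \<longlonglongrightarrow> ennreal (u $ z)"
        by (rule tendsto_ennrealI[OF u(1)])
      ultimately show "ennreal (u $ z) \<le> upper_expected_hitting_time \<T> A z"
        by (meson LIMSEQ_le_const2)
    qed
    then show ?thesis using u(1,2)[of z] by simp
  qed
  show ?thesis
  proof (intro conjI allI impI ballI; (elim conjE)?)
    show "\<exists>T. T extreme_point_of \<T>W"
      using extreme_point_exists_convex[OF compactW convexW nonempty] by blast
    show "\<exists>T'. T' extreme_point_of \<T>W \<and> (\<forall>z\<in>W. (T' *v h) $ z = (SUP S\<in>\<T>W. (S *v h) $ z))" for h
      using maximiser[of h] by blast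
  qed (fact transW reachW hitting_equation_unique_solution[OF extreme] | rule conv; assumption)+
qed

end
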